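(* Let $G$ and $H$ be graphs of coprime orders $N_1,N_2$ and positive edge counts $s_G,s_H$. Then $$\operatorname{FR}_{\min}(G\boxtimes H)\leq\frac{N_2\sqrt{s_G}\operatorname{FR}_{\min}(G)+N_1\sqrt{s_H}\operatorname{FR}_{\min}(H)+\sqrt{2s_Gs_H}\operatorname{FR}_{\min}(G)\operatorname{FR}_{\min}(H)}{\sqrt{N_2s_G+N_1s_H+2s_Gs_H}},$$ where $G\boxtimes H$ denotes the strong product.
   Context: Graphs are finite, simple and undirected. The weak product $G\times H$ has vertex set $V(G)\times V(H)$, with $(g_1,h_1)$ adjacent to $(g_2,h_2)$ if and only if $g_1$ is adjacent to $g_2$ in $G$ and $h_1$ is adjacent to $h_2$ in $H$. The Cartesian product $G\square H$ has the same vertex set, with $(g_1,h_1)$ adjacent to $(g_2,h_2)$ if and only if either $g_1=g_2$ and $h_1$ is adjacent to $h_2$, or $h_1=h_2$ and $g_1$ is adjacent to $g_2$. The strong product $G\boxtimes H$ is the union of the weak and Cartesian products on the common vertex set $V(G)\times V(H)$. A vertex labeling of a graph $G=(V,E)$ of order $N=|V|$ is a bijection $\sigma:V\to\mathbb Z_N=\mathbb Z/N\mathbb Z$. The adjacency matrix under $\sigma$ is the $N\times N$ matrix $A_\sigma$, indexed by $\mathbb Z_N\times\mathbb Z_N$, with $(A_\sigma)_{x,y}=1$ if the vertices labeled $x$ and $y$ are adjacent and $0$ otherwise. $F$ is the unitary Fourier matrix $F_{mx}=\frac1{\sqrt N}e^{-2\pi i mx/N}$. The Fourier ratio of a nonzero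 $N\times N$ matrix $M$ is $\operatorname{FR}(M)=\|FMF\|_1/\|FMF\|_2$, where $\|\cdot\|_1$ is the entrywise $\ell^1$-norm and $\|\cdot\|_2$ the Frobenius norm. The edge complexity of a graph with at least one edge is $\operatorname{FR}_{\min}(G)=\min_\sigma\operatorname{FR}(A_\sigma)$, the minimum over all vertex labelings (by $\mathbb Z_N$ with $N$ the order of that graph). *)

theory Defs
  imports Complex_Main "Graph_Theory.Pair_Digraph" "Jordan_Normal_Form.Matrix"
begin

text \<open>
  A finite simple undirected graph is a record satisfying \<^locale>\<open>pair_graph\<close>: a finite
  vertex set with a symmetric, irreflexive arc set, where \<open>(u, v)\<close> being an arc means that
  \<open>u\<close> and \<open>v\<close> are adjacent.
\<close>

definition graph_order :: "'a pair_pre_digraph \<Rightarrow> nat" where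
  "graph_order G = card (pverts G)"

text \<open>Each undirected edge is represented by two arcs but is counted once.\<close>

definition edge_count :: "'a pair_pre_digraph \<Rightarrow> nat" where
  "edge_count G = card {{u, v} | u v. (u, v) \<in> parcs G}"

definition weak_product ::
  "'a pair_pre_digraph \<Rightarrow> 'b pair_pre_digraph \<Rightarrow> ('a \<times> 'b) pair_pre_digraph" where
  "weak_product G H =
     \<lparr> pverts = pverts G \<times> pverts H,
       parcs = {((g1, h1), (g2, h2)) | g1 h1 g2 h2. (g1, g2) \<in> parcs G \<and> (h1, h2) \<in> parcs H} \<rparr>"

definition cartesian_product ::
  "'a pair_pre_digraph \<Rightarrow> 'b pair_pre_digraph \<Rightarrow> ('a \<times> 'b) pair_pre_digraph" where
  "cartesian_product G H =
     \<lparr> pverts = pverts G \<times> pverts H,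
       parcs = {((g1, h1), (g2, h2)) | g1 h1 g2 h2.
         g1 \<in> pverts G \<and> g2 \<in> pverts G \<and> h1 \<in> pverts H \<and> h2 \<in> pverts H \<and>
         (g1 = g2 \<and> (h1, h2) \<in> parcs H \<or> h1 = h2 \<and> (g1, g2) \<in> parcs G)} \<rparr>"

definition strong_product ::
  "'a pair_pre_digraph \<Rightarrow> 'b pair_pre_digraph \<Rightarrow> ('a \<times> 'b) pair_pre_digraph" where
  "strong_product G H =
     \<lparr> pverts = pverts G \<times> pverts H,
       parcs = parcs (weak_product G H) \<union> parcs (cartesian_product G H) \<rparr>"

text \<open>
  \<open>\<int>\<^sub>N\<close> is represented by the residues \<open>0, \<dots>, N - 1\<close>, which are also the row and column
  indices of an \<open>N \<times> N\<close> matrix.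
\<close>

definition vertex_labeling :: "'a pair_pre_digraph \<Rightarrow> ('a \<Rightarrow> nat) \<Rightarrow> bool" where
  "vertex_labeling G \<sigma> \<longleftrightarrow> bij_betw \<sigma> (pverts G) {..<graph_order G}"

definition adjacency_matrix :: "'a pair_pre_digraph \<Rightarrow> ('a \<Rightarrow> nat) \<Rightarrow> complex mat" where
  "adjacency_matrix G \<sigma> = mat (graph_order G) (graph_order G)
     (\<lambda>(x, y). if (inv_into (pverts G) \<sigma> x, inv_into (pverts G) \<sigma> y) \<in> parcs G then 1 else 0)"

definition fourier_matrix :: "nat \<Rightarrow> complex mat" where
  "fourier_matrix N = mat N N
     (\<lambda>(m, x). 1 / of_real (sqrt (real N)) *
       exp (- 2 * of_real pi * \<i> * of_nat m * of_nat x / of_nat N))"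

definition entrywise_l1_norm :: "complex mat \<Rightarrow> real" where
  "entrywise_l1_norm M = (\<Sum>i<dim_row M. \<Sum>j<dim_col M. cmod (M $$ (i, j)))"

definition frobenius_norm :: "complex mat \<Rightarrow> real" where
  "frobenius_norm M = sqrt (\<Sum>i<dim_row M. \<Sum>j<dim_col M. (cmod (M $$ (i, j)))\<^sup>2)"

text \<open>Meaningful for nonzero square matrices; it is 0 for a zero matrix, as \<open>x / 0 = 0\<close>.\<close>

definition fourier_ratio :: "complex mat \<Rightarrow> real" where
  "fourier_ratio M =
     (let F = fourier_matrix (dim_row M)
      in entrywise_l1_norm (F * M * F) / frobenius_norm (F * M * F))"

definition edge_complexity :: "'a pair_pre_digraph \<Rightarrow> real" where
  "edge_complexity G = Min {fourier_ratio (adjacency_matrix G \<sigma>) | \<sigma>. vertex_labeling G \<sigma>}"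

text \<open>
  The set in \<^const>\<open>edge_complexity\<close> is finite and nonempty, so its minimum is attained,
  although there are in general infinitely many \<open>\<sigma>\<close> because their values outside the vertex
  set are arbitrary.
\<close>

lemma finite_fourier_ratios:
  "finite {fourier_ratio (adjacency_matrix G \<sigma>) | \<sigma>. vertex_labeling G \<sigma>}"
proof -
  let ?n = "graph_order G"
  let ?B = "(\<lambda>S. mat ?n ?n (\<lambda>p. if p \<in> S then 1 else 0) :: complex mat) `
              Pow ({..<?n} \<times> {..<?n})"
  have "adjacency_matrix G \<sigma> \<in> ?B" for \<sigma>
  proof
    let ?S = "{(x, y). x < ?n \<and> y < ?n \<and>
      (inv_into (pverts G) \<sigma> x, inv_into (pverts G) \<sigma> y) \<in> parcs G}"
    show "adjacency_matrix G \<sigma> = mat ?n ?n (\<lambda>p. if p \<in> ?S then 1 else 0)"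
      by (rule eq_matI) (auto simp: adjacency_matrix_def)
    show "?S \<in> Pow ({..<?n} \<times> {..<?n})" by auto
  qed
  then have "{fourier_ratio (adjacency_matrix G \<sigma>) | \<sigma>. vertex_labeling G \<sigma>} \<subseteq> fourier_ratio ` ?B"
    by blast
  then show ?thesis
    by (rule finite_subset) simp
qed

lemma ex_vertex_labeling:
  assumes "finite (pverts G)"
  shows "\<exists>\<sigma>. vertex_labeling G \<sigma>"
  using ex_bij_betw_finite_nat[OF assms]
  by (auto simp: vertex_labeling_def graph_order_def atLeast0LessThan)

lemma pair_graph_strong_product:
  assumes "pair_graph G" "pair_graph H"
  shows "pair_graph (strong_product G H)"
proof -
  interpret G: pair_graph G by fact
  interpret H: pair_graph H by fact
  let ?P = "strong_product G H"
  have sub: "parcs ?P \<subseteq> pverts ?P \<times> pverts ?P"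
    by (auto simp: strong_product_def weak_product_def cartesian_product_def
        dest: G.in_arcsD1 G.in_arcsD2 H.in_arcsD1 H.in_arcsD2)
  have fin: "finite (pverts ?P)"
    by (simp add: strong_product_def)
  have sG: "(v, u) \<in> parcs G" if "(u, v) \<in> parcs G" for u v
    using that G.pair_sym_arcs by (auto simp: symmetric_def dest: symD)
  have sH: "(v, u) \<in> parcs H" if "(u, v) \<in> parcs H" for u v
    using that H.pair_sym_arcs by (auto simp: symmetric_def dest: symD)
  have sy: "sym (parcs ?P)"
    by (rule symI) (auto simp: strong_product_def weak_product_def cartesian_product_def
        intro: sG sH)
  have lf: "fst e \<noteq> snd e" if "e \<in> parcs ?P" for e
    using that by (auto simp: strong_product_def weak_product_def cartesian_product_def
        dest: G.no_loops' H.no_loops')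
  show ?thesis
  proof
    show "finite (parcs ?P)"
      using fin sub by (meson finite_SigmaI finite_subset)
    show "symmetric (with_proj ?P)"
      using sy by (simp add: symmetric_def)
  qed (use sub fin lf in auto)
qed

end

theory Submission
  imports Defs "HOL-Number_Theory.Cong"
begin

text \<open>
  Label \<open>(g, h)\<close> by the number modulo \<open>N\<^sub>1 N\<^sub>2\<close> that the Chinese remainder theorem attaches to
  optimal labels of \<open>g\<close> and \<open>h\<close>. The adjacency matrix of the strong product is then
  \<open>A\<^sub>G \<otimes> I + I \<otimes> A\<^sub>H + A\<^sub>G \<otimes> A\<^sub>H\<close>. If \<open>a N\<^sub>2 \<equiv> 1\<close> modulo \<open>N\<^sub>1\<close> and \<open>b N\<^sub>1 \<equiv> 1\<close> modulo \<open>N\<^sub>2\<close>,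
  the characters satisfy \<open>\<chi>(m x) = \<chi>\<^sub>1(a m x) \<chi>\<^sub>2(b m x)\<close>, and \<open>m \<mapsto> (a m, b m)\<close> is again a
  bijection onto pairs of residues, so the Fourier \<open>l\<^sup>1\<close>-norm of a tensor product is
  multiplicative. It equals \<open>N\<close> for the identity matrix and is subadditive, while by Parseval the
  Frobenius norm squared of a transformed adjacency matrix is twice the number of edges.
\<close>

section \<open>Additive characters and the two-dimensional Fourier transform\<close>

text \<open>The additive character of the integers modulo \<open>N\<close>, with the sign used in
  \<open>fourier_matrix\<close>. The argument is a natural number rather than a residue, so products
  of a frequency and a position can be passed unreduced.\<close>

definition chi :: "nat \<Rightarrow> nat \<Rightarrow> complex" where
  "chi N k = cis (- (2 * pi * real k / real N))"

lemma norm_chi [simp]: "cmod (chi N k) = 1"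
  by (simp add: chi_def)

lemma chi_add: "chi N (j + k) = chi N j * chi N k"
  by (simp add: chi_def cis_mult add_divide_distrib algebra_simps)

lemma chi_power: "chi N k ^ n = chi N (k * n)"
  by (simp add: chi_def DeMoivre algebra_simps)

lemma chi_eq_1_iff:
  assumes "N > 0"
  shows "chi N k = 1 \<longleftrightarrow> N dvd k"
proof
  assume "chi N k = 1"
  then have "cos (2 * pi * real k / real N) = 1"
    by (simp add: chi_def complex_eq_iff)
  then obtain n :: int where "2 * pi * real k / real N = real_of_int n * 2 * pi"
    by (subst (asm) cos_one_2pi_int) blast
  then have "real k = real_of_int n * real N"
    using assms by (simp add: field_simps)
  then have "int k = n * int N"
    by (metis of_int_eq_iff of_int_mult of_int_of_nat_eq)
  then have "int N dvd int k"
    by simp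
  then show "N dvd k"
    by simp
next
  assume "N dvd k"
  then obtain q where "k = N * q" ..
  then have "chi N k = cis (2 * pi * - real q)"
    using assms by (simp add: chi_def mult.assoc)
  also have "\<dots> = 1"
    by (rule cis_multiple_2pi) simp
  finally show "chi N k = 1" .
qed

lemma chi_mod:
  assumes "N > 0"
  shows "chi N (k mod N) = chi N k"
proof -
  have "chi N k = chi N (N * (k div N) + k mod N)"
    by simp
  also have "\<dots> = chi N (N * (k div N)) * chi N (k mod N)"
    by (rule chi_add)
  also have "chi N (N * (k div N)) = 1"
    using assms by (simp add: chi_eq_1_iff)
  finally show ?thesis
    by simp
qed

lemma chi_cong:
  assumes "N > 0" "[j = k] (mod N)"
  shows "chi N j = chi N k"
  using assms by (metis chi_mod cong_def)

lemma chi_mult_cancel: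
  assumes "M > 0"
  shows "chi (N * M) (k * M) = chi N k"
  using assms by (simp add: chi_def mult.assoc)

text \<open>Both sides are inverse to \<open>chi N (m * y)\<close>, the conjugate because the
  modulus is 1. Using \<open>N - y\<close> in place of a negative exponent keeps the argument
  natural, so that \<open>sum_chi\<close> applies in \<open>Parseval\<close>.\<close>

lemma cnj_chi_mult:
  assumes "N > 0" "y \<le> N"
  shows "cnj (chi N (m * y)) = chi N (m * (N - y))"
proof -
  have "chi N (m * (N - y)) * chi N (m * y) = chi N (m * N)"
    using assms by (simp flip: chi_add distrib_left)
  also have "\<dots> = 1"
    using assms by (simp add: chi_eq_1_iff)
  finally have *: "chi N (m * (N - y)) * chi N (m * y) = 1" .
  have "chi N (m * y) * cnj (chi N (m * y)) = 1"
    by (simp flip: complex_norm_square)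
  then show ?thesis
    by (metis * mult.commute mult.left_commute mult.right_neutral)
qed

text \<open>Orthogonality of characters: the terms are the powers of an \<open>N\<close>-th root of
  unity, and their geometric sum vanishes unless the root is 1.\<close>

lemma sum_chi:
  assumes "N > 0"
  shows "(\<Sum>x<N. chi N (x * k)) = (if N dvd k then of_nat N else 0)"
proof -
  have "(\<Sum>x<N. chi N (x * k)) = (\<Sum>x<N. chi N k ^ x)"
    by (simp add: chi_power mult.commute)
  also have "\<dots> = (if N dvd k then of_nat N else 0)"
  proof (cases "N dvd k")
    case True
    then have "chi N k = 1"
      using assms by (simp add: chi_eq_1_iff)
    with True show ?thesis
      by simp
  next
    case False
    then have "chi N k \<noteq> 1"
      using assms by (simp add: chi_eq_1_iff)
    moreover have "chi N k ^ N = 1"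
      using assms by (simp add: chi_power chi_eq_1_iff)
    ultimately show ?thesis
      using False by (simp add: geometric_sum)
  qed
  finally show ?thesis .
qed

text \<open>Expand the squared modulus into a double sum and move the sum over frequencies inside;
  orthogonality leaves only the diagonal. The factor \<open>N\<close> appears because the transform
  here is not normalized.\<close>

lemma Parseval:
  assumes N: "N > 0"
  shows "(\<Sum>m<N. (cmod (\<Sum>x<N. f x * chi N (m * x)))\<^sup>2) = real N * (\<Sum>x<N. (cmod (f x))\<^sup>2)"
proof -
  have dvd_iff: "N dvd x + N - y \<longleftrightarrow> y = x" if "x < N" "y < N" for x y
  proof
    assume "N dvd x + N - y"
    then obtain q where q: "x + N - y = N * q" ..
    \<comment> \<open>The number \<open>x + N - y\<close> lies strictly between 0 and
      \<open>2 * N\<close>, so \<open>N\<close> is the only multiple of \<open>N\<close> it can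
      equal.\<close>
    have "N * q < N * 2" "0 < N * q"
      using q that by linarith+
    then have "q = 1"
      by simp
    then show "y = x"
      using q that by simp
  qed (use that in simp)
  have "complex_of_real (\<Sum>m<N. (cmod (\<Sum>x<N. f x * chi N (m * x)))\<^sup>2)
      = (\<Sum>m<N. (\<Sum>x<N. f x * chi N (m * x)) * cnj (\<Sum>y<N. f y * chi N (m * y)))"
    by (simp add: complex_norm_square del: of_real_power)
  also have "\<dots> = (\<Sum>m<N. \<Sum>x<N. \<Sum>y<N. f x * cnj (f y) * chi N (m * (x + (N - y))))"
  proof (intro sum.cong refl)
    fix m
    have "f x * chi N (m * x) * cnj (f y * chi N (m * y)) = f x * cnj (f y) * chi N (m * (x + (N - y)))"
      if "y < N" for x y
    proof -
      have "chi N (m * (x + (N - y))) = chi N (m * x) * cnj (chi N (m * y))"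
        unfolding distrib_left chi_add using cnj_chi_mult[OF N] that by simp
      then show ?thesis
        by (simp only: complex_cnj_mult mult_ac)
    qed
    then show "(\<Sum>x<N. f x * chi N (m * x)) * cnj (\<Sum>y<N. f y * chi N (m * y))
        = (\<Sum>x<N. \<Sum>y<N. f x * cnj (f y) * chi N (m * (x + (N - y))))"
      unfolding cnj_sum sum_product by (intro sum.cong refl) simp_all
  qed
  also have "\<dots> = (\<Sum>x<N. \<Sum>m<N. \<Sum>y<N. f x * cnj (f y) * chi N (m * (x + (N - y))))"
    by (rule sum.swap)
  also have "\<dots> = (\<Sum>x<N. \<Sum>y<N. \<Sum>m<N. f x * cnj (f y) * chi N (m * (x + (N - y))))"
    by (intro sum.cong refl sum.swap)
  also have "\<dots> = (\<Sum>x<N. \<Sum>y<N. f x * cnj (f y) * (\<Sum>m<N. chi N (m * (x + (N - y)))))"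
    by (simp add: sum_distrib_left)
  also have "\<dots> = (\<Sum>x<N. \<Sum>y<N. if y = x then f x * cnj (f y) * of_nat N else 0)"
    using N by (intro sum.cong refl) (simp add: sum_chi dvd_iff del: of_nat_add)
  also have "\<dots> = complex_of_real (real N * (\<Sum>x<N. (cmod (f x))\<^sup>2))"
    by (simp add: sum_distrib_left complex_norm_square mult_ac del: of_real_power)
  finally show ?thesis
    by (simp only: of_real_eq_iff)
qed

text \<open>The entries of \<open>F * A * F\<close> for the unitary Fourier matrix \<open>F\<close>:
  the two factors \<open>1 / sqrt N\<close> combine to \<open>1 / N\<close>, and both characters
  have the same sign because no adjoint is taken. Working with functions lets tensor products be
  written through residues.\<close>

definition dft2 :: "nat \<Rightarrow> (nat \<Rightarrow> nat \<Rightarrow> complex) \<Rightarrow> nat \<Rightarrow> nat \<Rightarrow> complex" where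
  "dft2 N A m n = (\<Sum>x<N. \<Sum>y<N. A x y * chi N (m * x) * chi N (n * y)) / of_nat N"

definition dft2_l1 :: "nat \<Rightarrow> (nat \<Rightarrow> nat \<Rightarrow> complex) \<Rightarrow> real" where
  "dft2_l1 N A = (\<Sum>m<N. \<Sum>n<N. cmod (dft2 N A m n))"

text \<open>One-dimensional \<open>Parseval\<close> is used once in each variable; each use gives a
  factor \<open>N\<close>, and together they cancel the normalization.\<close>

lemma Parseval_dft2:
  assumes N: "N > 0"
  shows "(\<Sum>m<N. \<Sum>n<N. (cmod (dft2 N A m n))\<^sup>2) = (\<Sum>x<N. \<Sum>y<N. (cmod (A x y))\<^sup>2)"
proof -
  define g where "g n x = (\<Sum>y<N. A x y * chi N (n * y))" for n x
  have "dft2 N A m n = (\<Sum>x<N. g n x * chi N (m * x)) / of_nat N" for m n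
    unfolding dft2_def g_def
    by (simp add: sum_distrib_left sum_distrib_right mult_ac)
  then have "(cmod (dft2 N A m n))\<^sup>2 = (cmod (\<Sum>x<N. g n x * chi N (m * x)))\<^sup>2 / (real N)\<^sup>2" for m n
    by (simp add: norm_divide power_divide)
  then have "(\<Sum>m<N. \<Sum>n<N. (cmod (dft2 N A m n))\<^sup>2)
      = (\<Sum>m<N. \<Sum>n<N. (cmod (\<Sum>x<N. g n x * chi N (m * x)))\<^sup>2) / (real N)\<^sup>2"
    by (simp add: sum_divide_distrib)
  also have "(\<Sum>m<N. \<Sum>n<N. (cmod (\<Sum>x<N. g n x * chi N (m * x)))\<^sup>2)
      = (\<Sum>n<N. real N * (\<Sum>x<N. (cmod (g n x))\<^sup>2))"
    by (subst sum.swap) (simp add: Parseval[OF N])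
  also have "\<dots> = real N * (\<Sum>x<N. \<Sum>n<N. (cmod (g n x))\<^sup>2)"
    by (subst sum.swap) (simp add: sum_distrib_left)
  also have "\<dots> = real N * (\<Sum>x<N. real N * (\<Sum>y<N. (cmod (A x y))\<^sup>2))"
    by (simp add: g_def Parseval[OF N])
  also have "\<dots> = (real N)\<^sup>2 * (\<Sum>x<N. \<Sum>y<N. (cmod (A x y))\<^sup>2)"
    by (simp add: power2_eq_square[of "real N"] mult.assoc flip: sum_distrib_left)
  finally show ?thesis
    using N by simp
qed

text \<open>The frequencies \<open>a * m\<close> and \<open>b * m\<close> in
  \<open>dft2_tensor\<close> arrive unreduced; periodicity brings them back into range.\<close>

lemma dft2_mod:
  assumes "N > 0"
  shows "dft2 N A (m mod N) (n mod N) = dft2 N A m n"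
proof -
  have "chi N (k mod N * x) = chi N (k * x)" for k x
    by (rule chi_cong[OF assms]) (simp add: cong_def mod_mult_left_eq)
  then show ?thesis
    by (simp add: dft2_def)
qed

lemma dft2_l1_cong:
  assumes "\<And>x y. x < N \<Longrightarrow> y < N \<Longrightarrow> A x y = B x y"
  shows "dft2_l1 N A = dft2_l1 N B"
  using assms by (simp add: dft2_l1_def dft2_def)

lemma dft2_l1_add: "dft2_l1 N (\<lambda>x y. A x y + B x y) \<le> dft2_l1 N A + dft2_l1 N B"
proof -
  have "dft2 N (\<lambda>x y. A x y + B x y) m n = dft2 N A m n + dft2 N B m n" for m n
    by (simp add: dft2_def distrib_right sum.distrib add_divide_distrib)
  then show ?thesis
    by (simp add: dft2_l1_def sum.distrib[symmetric] sum_mono norm_triangle_ineq)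
qed

text \<open>The square of the Fourier matrix is the permutation matrix of negation modulo
  \<open>N\<close>, so exactly \<open>N\<close> entries have modulus 1 and the others
  vanish.\<close>

lemma dft2_l1_identity:
  assumes N: "N > 0"
  shows "dft2_l1 N (\<lambda>x y. of_bool (x = y)) = real N"
proof -
  \<comment> \<open>\<open>(N - m) mod N\<close> is the negative of \<open>m\<close>; the outer
    \<open>mod\<close> matters only for \<open>m = 0\<close>, where \<open>N - m\<close> would be
    out of range.\<close>
  have dvd_iff: "N dvd m + n \<longleftrightarrow> n = (N - m) mod N" if "m < N" "n < N" for m n
  proof (cases "m = 0")
    case False
    have "N dvd m + n \<longleftrightarrow> m + n = N"
    proof
      assume "N dvd m + n"
      then obtain q where q: "m + n = N * q" ..
      have "N * q < N * 2" "0 < N * q"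
        using q that False by linarith+
      then have "q = 1"
        by simp
      then show "m + n = N"
        using q by simp
    qed simp
    then show ?thesis
      using False that by auto
  qed (use that in auto)
  have "(\<Sum>y<N. of_bool (x = y) * chi N (m * x) * chi N (n * y)) = chi N (x * (m + n))"
    if "x < N" for x m n
  proof -
    have "(\<Sum>y<N. of_bool (x = y) * chi N (m * x) * chi N (n * y))
        = (\<Sum>y<N. if y = x then chi N (m * x) * chi N (n * y) else 0)"
      by (intro sum.cong) auto
    also have "\<dots> = chi N (x * (m + n))"
      using that by (simp add: chi_add distrib_left mult.commute)
    finally show ?thesis .
  qed
  then have "cmod (dft2 N (\<lambda>x y. of_bool (x = y)) m n) = of_bool (N dvd m + n)" for m n
    using N by (simp add: dft2_def sum_chi)
  then have "dft2_l1 N (\<lambda>x y. of_bool (x = y)) = (\<Sum>m<N. \<Sum>n<N. of_bool (N dvd m + n))"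
    by (simp add: dft2_l1_def)
  also have "\<dots> = (\<Sum>m<N. \<Sum>n<N. if n = (N - m) mod N then 1 else 0)"
    by (intro sum.cong refl) (simp add: dvd_iff)
  also have "\<dots> = real N"
    using N by simp
  finally show ?thesis .
qed

section \<open>Tensor products under the Chinese remainder theorem\<close>

text \<open>The units \<open>a\<close> and \<open>b\<close> can be cancelled, after which the
  Chinese remainder theorem gives injectivity; equal cardinalities give the rest. Positions use
  \<open>a = b = 1\<close>, frequencies use the inverses from \<open>dft2_tensor\<close>.\<close>

lemma bij_betw_crt:
  fixes M N a b :: nat
  assumes "coprime M N" "coprime a M" "coprime b N" "M > 0" "N > 0"
  shows "bij_betw (\<lambda>x. (a * x mod M, b * x mod N)) {..<M * N} ({..<M} \<times> {..<N})"
proof -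
  have "inj_on (\<lambda>x. (a * x mod M, b * x mod N)) {..<M * N}"
  proof (rule inj_onI)
    fix x y
    assume x: "x \<in> {..<M * N}" and y: "y \<in> {..<M * N}"
      and "(a * x mod M, b * x mod N) = (a * y mod M, b * y mod N)"
    then have "[a * x = a * y] (mod M)" "[b * x = b * y] (mod N)"
      by (auto simp: cong_def)
    then have "[x = y] (mod M)" "[x = y] (mod N)"
      using assms by (simp_all add: cong_mult_lcancel_nat)
    then have "[x = y] (mod M * N)"
      using assms by (simp add: coprime_cong_mult_nat)
    then show "x = y"
      using x y by (simp add: cong_less_modulus_unique_nat)
  qed
  moreover have "(\<lambda>x. (a * x mod M, b * x mod N)) ` {..<M * N} \<subseteq> {..<M} \<times> {..<N}"
    using assms by auto
  ultimately show ?thesis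
    by (intro bij_betw_imageI card_subset_eq) (auto simp: card_image)
qed

lemma sum_crt:
  fixes M N a b :: nat
  assumes "coprime M N" "coprime a M" "coprime b N" "M > 0" "N > 0"
  shows "(\<Sum>x<M * N. f (a * x mod M) (b * x mod N)) = (\<Sum>i<M. \<Sum>j<N. f i j)"
proof -
  have "(\<Sum>x<M * N. f (a * x mod M) (b * x mod N)) = (\<Sum>(i, j)\<in>{..<M} \<times> {..<N}. f i j)"
    using sum.reindex_bij_betw[OF bij_betw_crt[OF assms], of "\<lambda>(i, j). f i j"] by simp
  then show ?thesis
    by (simp add: sum.cartesian_product)
qed

lemma sum_crt':
  fixes M N :: nat
  assumes "coprime M N" "M > 0" "N > 0"
  shows "(\<Sum>x<M * N. f (x mod M) (x mod N)) = (\<Sum>i<M. \<Sum>j<N. f i j)"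
  using sum_crt[OF assms(1) _ _ assms(2,3), of 1 1 f] by simp

lemma sum_tensor:
  fixes F G :: "nat \<Rightarrow> nat \<Rightarrow> 'c::comm_semiring_0"
  shows "(\<Sum>i<M. \<Sum>j<N. \<Sum>k<M. \<Sum>l<N. F i k * G j l)
    = (\<Sum>i<M. \<Sum>k<M. F i k) * (\<Sum>j<N. \<Sum>l<N. G j l)"
proof -
  have "(\<Sum>i<M. \<Sum>j<N. \<Sum>k<M. \<Sum>l<N. F i k * G j l)
      = (\<Sum>i<M. \<Sum>j<N. (\<Sum>k<M. F i k) * (\<Sum>l<N. G j l))"
    by (simp only: sum_product)
  also have "\<dots> = (\<Sum>i<M. \<Sum>k<M. F i k) * (\<Sum>j<N. \<Sum>l<N. G j l)"
    by (simp only: sum_product[of "\<lambda>i. \<Sum>k<M. F i k"])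
  finally show ?thesis .
qed

lemma dft2_tensor:
  assumes cop: "coprime M N" and "M > 0" "N > 0"
    and a: "[a * N = 1] (mod M)" and b: "[b * M = 1] (mod N)"
  shows "dft2 (M * N) (\<lambda>x y. A (x mod M) (y mod M) * B (x mod N) (y mod N)) m n
    = dft2 M A (a * m) (a * n) * dft2 N B (b * m) (b * n)"
proof -
  have split: "chi (M * N) (m * x) = chi M (a * m * (x mod M)) * chi N (b * m * (x mod N))" for m x
  proof -
    \<comment> \<open>This is the Chinese remainder form of 1: one summand vanishes and the other is
      1 modulo each factor. Multiplying \<open>m * x\<close> by it splits the character.\<close>
    have "[a * N + b * M = 1] (mod M)" "[a * N + b * M = 1] (mod N)"
      using a b by (simp_all add: cong_def)
    then have "[a * N + b * M = 1] (mod M * N)"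
      using cop by (rule coprime_cong_mult_nat)
    then have "[(a * N + b * M) * (m * x) = 1 * (m * x)] (mod M * N)"
      by (rule cong_scalar_right)
    then have "chi (M * N) (m * x) = chi (M * N) ((a * N + b * M) * (m * x))"
      using assms by (intro chi_cong) (auto intro: cong_sym)
    \<comment> \<open>The second modulus is turned into \<open>N * M\<close> so that each factor has
      the shape of \<open>chi_mult_cancel\<close>.\<close>
    also have "\<dots> = chi (M * N) (a * m * x * N) * chi (N * M) (b * m * x * M)"
      unfolding distrib_right chi_add by (simp only: mult_ac)
    also have "\<dots> = chi M (a * m * x) * chi N (b * m * x)"
      using assms by (simp only: chi_mult_cancel)
    also have "chi M (a * m * x) = chi M (a * m * (x mod M))"
      by (rule chi_cong[OF \<open>M > 0\<close>]) (simp add: cong_def mod_mult_right_eq)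
    also have "chi N (b * m * x) = chi N (b * m * (x mod N))"
      by (rule chi_cong[OF \<open>N > 0\<close>]) (simp add: cong_def mod_mult_right_eq)
    finally show ?thesis .
  qed
  define F where "F i k = A i k * chi M (a * m * i) * chi M (a * n * k)" for i k
  define G where "G j l = B j l * chi N (b * m * j) * chi N (b * n * l)" for j l
  have "(\<Sum>x<M * N. \<Sum>y<M * N. A (x mod M) (y mod M) * B (x mod N) (y mod N)
        * chi (M * N) (m * x) * chi (M * N) (n * y))
      = (\<Sum>x<M * N. \<Sum>y<M * N. F (x mod M) (y mod M) * G (x mod N) (y mod N))"
    unfolding split F_def G_def by (simp only: mult_ac)
  \<comment> \<open>The residues of \<open>y\<close> are separated for fixed \<open>x\<close>, then
    those of \<open>x\<close>; this produces the interleaved order that \<open>sum_tensor\<close>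
    undoes.\<close>
  also have "\<dots> = (\<Sum>x<M * N. \<Sum>k<M. \<Sum>l<N. F (x mod M) k * G (x mod N) l)"
    using assms by (intro sum.cong refl sum_crt')
  also have "\<dots> = (\<Sum>i<M. \<Sum>j<N. \<Sum>k<M. \<Sum>l<N. F i k * G j l)"
    using assms by (intro sum_crt')
  also have "\<dots> = (\<Sum>i<M. \<Sum>k<M. F i k) * (\<Sum>j<N. \<Sum>l<N. G j l)"
    by (rule sum_tensor)
  finally show ?thesis
    by (simp add: dft2_def F_def G_def)
qed

text \<open>By \<open>dft2_tensor\<close> the transform is a product up to the twist of frequencies
  by \<open>a\<close> and \<open>b\<close>. Being inverses, these are units, so the twist only
  permutes entries and the sum of moduli does not see it.\<close>

lemma dft2_l1_tensor:
  assumes cop: "coprime M N" and pos: "M > 0" "N > 0"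
  shows "dft2_l1 (M * N) (\<lambda>x y. A (x mod M) (y mod M) * B (x mod N) (y mod N))
    = dft2_l1 M A * dft2_l1 N B"
proof -
  obtain a where a: "[a * N = 1] (mod M)"
    using cop by (metis cong_solve_coprime_nat coprime_commute mult.commute One_nat_def)
  obtain b where b: "[b * M = 1] (mod N)"
    using cop by (metis cong_solve_coprime_nat mult.commute One_nat_def)
  have cop': "coprime a M" "coprime b N"
    using a b pos
    by (metis coprime_iff_invertible_nat One_nat_def)+
  define F where "F m n = cmod (dft2 M A m n)" for m n
  define G where "G m n = cmod (dft2 N B m n)" for m n
  have "dft2_l1 (M * N) (\<lambda>x y. A (x mod M) (y mod M) * B (x mod N) (y mod N))
      = (\<Sum>m<M * N. \<Sum>n<M * N. F (a * m mod M) (a * n mod M) * G (b * m mod N) (b * n mod N))"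
    using pos by (simp add: dft2_l1_def dft2_tensor[OF cop pos a b] norm_mult dft2_mod F_def G_def)
  also have "\<dots> = (\<Sum>m<M * N. \<Sum>k<M. \<Sum>l<N. F (a * m mod M) k * G (b * m mod N) l)"
    using cop pos cop' by (intro sum.cong refl sum_crt)
  also have "\<dots> = (\<Sum>i<M. \<Sum>j<N. \<Sum>k<M. \<Sum>l<N. F i k * G j l)"
    using cop pos cop' by (intro sum_crt)
  also have "\<dots> = (\<Sum>i<M. \<Sum>k<M. F i k) * (\<Sum>j<N. \<Sum>l<N. G j l)"
    by (rule sum_tensor)
  finally show ?thesis
    by (simp add: dft2_l1_def F_def G_def)
qed

section \<open>From Fourier matrices to \<open>dft2\<close>\<close>

lemma fourier_matrix_index:
  assumes "m < N" "x < N"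
  shows "fourier_matrix N $$ (m, x) = chi N (m * x) / of_real (sqrt (real N))"
  using assms by (simp add: fourier_matrix_def chi_def cis_conv_exp mult_ac)

lemma fourier_conj_index:
  assumes M: "M \<in> carrier_mat N N" and "m < N" "n < N"
  shows "(fourier_matrix N * M * fourier_matrix N) $$ (m, n) = dft2 N (\<lambda>x y. M $$ (x, y)) m n"
proof -
  let ?r = "complex_of_real (sqrt (real N))"
  have F: "fourier_matrix N \<in> carrier_mat N N"
    by (simp add: fourier_matrix_def)
  have "(fourier_matrix N * M * fourier_matrix N) $$ (m, n)
      = (\<Sum>x<N. fourier_matrix N $$ (m, x) * (\<Sum>y<N. M $$ (x, y) * fourier_matrix N $$ (y, n)))"
    using assms F by (simp add: scalar_prod_def atLeast0LessThan)
  also have "\<dots> = (\<Sum>x<N. \<Sum>y<N. M $$ (x, y) * chi N (m * x) * chi N (n * y) / (?r * ?r))"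
    using assms by (simp add: fourier_matrix_index sum_distrib_left mult_ac)
  also have "?r * ?r = of_nat N"
    by (simp flip: of_real_mult)
  finally show ?thesis
    by (simp add: dft2_def sum_divide_distrib)
qed

text \<open>Only the numerator needs the transform: by Parseval the Frobenius norm is unchanged by
  it.\<close>

lemma fourier_ratio_eq:
  assumes M: "M \<in> carrier_mat N N" and "N > 0"
  shows "fourier_ratio M = dft2_l1 N (\<lambda>x y. M $$ (x, y))
    / sqrt (\<Sum>x<N. \<Sum>y<N. (cmod (M $$ (x, y)))\<^sup>2)"
proof -
  let ?K = "fourier_matrix N * M * fourier_matrix N"
  have dim: "dim_row ?K = N" "dim_col ?K = N"
    by (simp_all add: fourier_matrix_def)
  have "entrywise_l1_norm ?K = dft2_l1 N (\<lambda>x y. M $$ (x, y))"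
    unfolding entrywise_l1_norm_def dft2_l1_def dim
    by (intro sum.cong refl) (simp add: fourier_conj_index[OF M] del: index_mult_mat)
  moreover have "frobenius_norm ?K = sqrt (\<Sum>x<N. \<Sum>y<N. (cmod (M $$ (x, y)))\<^sup>2)"
  proof -
    have "(\<Sum>m<N. \<Sum>n<N. (cmod (?K $$ (m, n)))\<^sup>2)
        = (\<Sum>m<N. \<Sum>n<N. (cmod (dft2 N (\<lambda>x y. M $$ (x, y)) m n))\<^sup>2)"
      by (intro sum.cong refl) (simp add: fourier_conj_index[OF M] del: index_mult_mat)
    then show ?thesis
      unfolding frobenius_norm_def dim by (simp only: Parseval_dft2[OF \<open>N > 0\<close>])
  qed
  ultimately show ?thesis
    using M by (simp add: fourier_ratio_def)
qed

section \<open>Adjacency matrices and edge counts\<close>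

text \<open>The map from arcs to unordered edges has fibres of size exactly two, by symmetry and
  absence of loops.\<close>

lemma card_parcs:
  assumes "pair_graph G"
  shows "card (parcs G) = 2 * edge_count G"
proof -
  interpret pair_graph G by fact
  let ?edge = "\<lambda>(u, v). {u, v}"
  have edges: "{{u, v} | u v. (u, v) \<in> parcs G} = ?edge ` parcs G"
    by auto
  have "card {a \<in> parcs G. ?edge a = e} = 2" if e: "e \<in> ?edge ` parcs G" for e
  proof -
    obtain u v where uv: "(u, v) \<in> parcs G" "e = {u, v}"
      using e by auto
    then have "(v, u) \<in> parcs G" "u \<noteq> v"
      using arcs_symmetric no_loops' by auto
    moreover from this uv have "{a \<in> parcs G. ?edge a = e} = {(u, v), (v, u)}"
      by (auto simp: doubleton_eq_iff)
    ultimately show ?thesis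
      by simp
  qed
  moreover have "card (parcs G) = (\<Sum>e \<in> ?edge ` parcs G. card {a \<in> parcs G. ?edge a = e})"
    using sum.image_gen[OF pair_finite_arcs, of "\<lambda>_. 1::nat" ?edge] by simp
  ultimately show ?thesis
    by (simp add: edge_count_def edges)
qed

lemma sum_of_bool_parcs:
  assumes "pair_graph G" and f: "bij_betw f {..<N} (pverts G)"
  shows "(\<Sum>x<N. \<Sum>y<N. of_bool ((f x, f y) \<in> parcs G)) = (2 * real (edge_count G))"
proof -
  interpret pair_graph G by fact
  have sub: "parcs G \<subseteq> pverts G \<times> pverts G"
    using wellformed' by auto
  have "(\<Sum>x<N. \<Sum>y<N. of_bool ((f x, f y) \<in> parcs G))
      = (\<Sum>u\<in>pverts G. \<Sum>v\<in>pverts G. of_bool ((u, v) \<in> parcs G))"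
    by (simp add: sum.reindex_bij_betw[OF f, of "\<lambda>v. of_bool ((_, v) \<in> parcs G)"]
        sum.reindex_bij_betw[OF f, of "\<lambda>u. \<Sum>v\<in>pverts G. of_bool ((u, v) \<in> parcs G)"])
  also have "\<dots> = (\<Sum>a\<in>pverts G \<times> pverts G. of_bool (a \<in> parcs G))"
    by (simp add: sum.cartesian_product case_prod_unfold)
  also have "\<dots> = real (card (parcs G))"
    using sub pair_finite_verts by (simp add: Int_absorb1)
  finally show ?thesis
    by (simp add: card_parcs[OF assms(1)])
qed

text \<open>The entries are 0 or 1, hence equal to their squares, so the squared Frobenius norm
  counts arcs, which is twice the number of edges.\<close>

lemma fourier_ratio_adjacency_matrix:
  assumes "pair_graph G" "vertex_labeling G \<sigma>" "graph_order G > 0"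
  shows "fourier_ratio (adjacency_matrix G \<sigma>) = dft2_l1 (graph_order G)
      (\<lambda>x y. of_bool ((inv_into (pverts G) \<sigma> x, inv_into (pverts G) \<sigma> y) \<in> parcs G))
    / sqrt (2 * real (edge_count G))"
proof -
  let ?N = "graph_order G" and ?f = "inv_into (pverts G) \<sigma>"
  have adj: "adjacency_matrix G \<sigma> $$ (x, y) = of_bool ((?f x, ?f y) \<in> parcs G)"
    if "x < ?N" "y < ?N" for x y
    using that by (simp add: adjacency_matrix_def)
  have f: "bij_betw ?f {..<?N} (pverts G)"
    using assms(2) by (auto simp: vertex_labeling_def intro: bij_betw_inv_into)
  have "(\<Sum>x<?N. \<Sum>y<?N. (cmod (adjacency_matrix G \<sigma> $$ (x, y)))\<^sup>2)
      = (\<Sum>x<?N. \<Sum>y<?N. of_bool ((?f x, ?f y) \<in> parcs G))"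
    by (intro sum.cong refl) (simp add: adj)
  also have "\<dots> = 2 * real (edge_count G)"
    by (rule sum_of_bool_parcs[OF assms(1) f])
  finally have norm: "(\<Sum>x<?N. \<Sum>y<?N. (cmod (adjacency_matrix G \<sigma> $$ (x, y)))\<^sup>2)
      = 2 * real (edge_count G)" .
  have "adjacency_matrix G \<sigma> \<in> carrier_mat ?N ?N"
    by (simp add: adjacency_matrix_def)
  from fourier_ratio_eq[OF this assms(3)] show ?thesis
    unfolding norm using adj by (simp cong: dft2_l1_cong)
qed

section \<open>Edge complexity as an attained minimum\<close>

lemma edge_complexity_attained:
  assumes "finite (pverts G)"
  obtains \<sigma> where "vertex_labeling G \<sigma>" "edge_complexity G = fourier_ratio (adjacency_matrix G \<sigma>)"
proof -
  have "edge_complexity G \<in> {fourier_ratio (adjacency_matrix G \<sigma>) | \<sigma>. vertex_labeling G \<sigma>}"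
    unfolding edge_complexity_def
    using finite_fourier_ratios ex_vertex_labeling[OF assms] by (intro Min_in) auto
  then show thesis
    using that by blast
qed

lemma edge_complexity_le:
  assumes "vertex_labeling G \<sigma>"
  shows "edge_complexity G \<le> fourier_ratio (adjacency_matrix G \<sigma>)"
  unfolding edge_complexity_def using assms by (intro Min_le finite_fourier_ratios) auto

section \<open>Order, edges and arcs of the strong product\<close>

lemma graph_order_strong_product:
  "graph_order (strong_product G H) = graph_order G * graph_order H"
  by (simp add: graph_order_def card_cartesian_product strong_product_def)

text \<open>Arcs are counted instead of edges: they fall into three families according to which
  coordinates move. When both move there are four arcs for each pair of edges, whence the
  coefficient 2 after halving.\<close>

lemma edge_count_strong_product:
  assumes "pair_graph G" "pair_graph H"
  shows "edge_count (strong_product G H)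
    = graph_order H * edge_count G + graph_order G * edge_count H + 2 * edge_count G * edge_count H"
proof -
  interpret G: pair_graph G by fact
  interpret H: pair_graph H by fact
  let ?a = "\<lambda>((g1, g2), h). ((g1, h), (g2, h))"
  let ?b = "\<lambda>(g, (h1, h2)). ((g, h1), (g, h2))"
  let ?c = "\<lambda>((g1, g2), (h1, h2)). ((g1, h1), (g2, h2))"
  let ?A = "?a ` (parcs G \<times> pverts H)" and ?B = "?b ` (pverts G \<times> parcs H)"
    and ?C = "?c ` (parcs G \<times> parcs H)"
  have A: "((g1, h1), (g2, h2)) \<in> ?A \<longleftrightarrow> (g1, g2) \<in> parcs G \<and> h1 = h2 \<and> h1 \<in> pverts H"
    for g1 g2 h1 h2
    by (force simp: image_iff)
  have B: "((g1, h1), (g2, h2)) \<in> ?B \<longleftrightarrow> g1 = g2 \<and> g1 \<in> pverts G \<and> (h1, h2) \<in> parcs H"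
    for g1 g2 h1 h2
    by (force simp: image_iff)
  have C: "((g1, h1), (g2, h2)) \<in> ?C \<longleftrightarrow> (g1, g2) \<in> parcs G \<and> (h1, h2) \<in> parcs H"
    for g1 g2 h1 h2
    by (force simp: image_iff)
  have "((g1, h1), (g2, h2)) \<in> parcs (strong_product G H)
      \<longleftrightarrow> ((g1, h1), (g2, h2)) \<in> ?A \<union> ?B \<union> ?C" for g1 h1 g2 h2
    unfolding Un_iff A B C using G.wellformed' H.wellformed'
    by (auto simp: strong_product_def weak_product_def cartesian_product_def)
  then have "parcs (strong_product G H) = ?A \<union> ?B \<union> ?C"
    by (simp only: set_eq_iff split_paired_All) blast
  moreover have "card (?A \<union> ?B \<union> ?C) = card ?A + card ?B + card ?C"
  proof -
    \<comment> \<open>Arcs in \<open>?A\<close> change only the first coordinate, those in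
      \<open>?B\<close> only the second and those in \<open>?C\<close> both, since neither factor
      has loops.\<close>
    have "a \<notin> ?A \<inter> ?B" "a \<notin> (?A \<union> ?B) \<inter> ?C" for a
    proof -
      obtain g1 h1 g2 h2 where a: "a = ((g1, h1), (g2, h2))"
        by (metis surj_pair)
      show "a \<notin> ?A \<inter> ?B" "a \<notin> (?A \<union> ?B) \<inter> ?C"
        unfolding a Int_iff Un_iff A B C using G.no_loops' H.no_loops' by auto
    qed
    then have "?A \<inter> ?B = {}" "(?A \<union> ?B) \<inter> ?C = {}"
      by blast+
    moreover have "finite ?A" "finite ?B" "finite ?C"
      by simp_all
    ultimately show ?thesis
      by (simp only: card_Un_disjoint finite_Un simp_thms)
  qed
  moreover have "inj_on ?a (parcs G \<times> pverts H)" "inj_on ?b (pverts G \<times> parcs H)"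
      "inj_on ?c (parcs G \<times> parcs H)"
    by (auto intro!: inj_onI)
  then have "card ?A = 2 * edge_count G * graph_order H"
      "card ?B = graph_order G * (2 * edge_count H)"
      "card ?C = 2 * edge_count G * (2 * edge_count H)"
    by (simp_all only: card_image card_cartesian_product card_parcs[OF assms(1)]
        card_parcs[OF assms(2)] graph_order_def)
  ultimately have "2 * edge_count (strong_product G H)
      = 2 * (graph_order H * edge_count G + graph_order G * edge_count H + 2 * edge_count G * edge_count H)"
    by (simp add: card_parcs[OF pair_graph_strong_product[OF assms], symmetric] algebra_simps)
  then show ?thesis
    by simp
qed

lemma edge_count_pos_imp_order_pos:
  assumes "pair_graph G" "edge_count G > 0"
  shows "graph_order G > 0"
proof -
  interpret pair_graph G by fact
  from assms card_parcs[OF assms(1)] have "parcs G \<noteq> {}"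
    by auto
  then have "pverts G \<noteq> {}"
    using wellformed' by auto
  then show ?thesis
    by (simp add: graph_order_def card_gt_0_iff)
qed

text \<open>Without loops the three kinds of adjacency exclude each other, so the disjunction
  becomes a sum of indicators. This is the tensor decomposition of the adjacency matrix, entry by
  entry.\<close>

lemma of_bool_strong_product_parcs:
  assumes "pair_graph G" "pair_graph H"
    and "g1 \<in> pverts G" "g2 \<in> pverts G" "h1 \<in> pverts H" "h2 \<in> pverts H"
  shows "(of_bool (((g1, h1), (g2, h2)) \<in> parcs (strong_product G H)) :: 'c::semiring_1)
    = of_bool ((g1, g2) \<in> parcs G) * of_bool (h1 = h2)
    + of_bool (g1 = g2) * of_bool ((h1, h2) \<in> parcs H)
    + of_bool ((g1, g2) \<in> parcs G) * of_bool ((h1, h2) \<in> parcs H)"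
proof -
  interpret G: pair_graph G by fact
  interpret H: pair_graph H by fact
  have "((g1, h1), (g2, h2)) \<in> parcs (strong_product G H) \<longleftrightarrow>
      (g1, g2) \<in> parcs G \<and> h1 = h2 \<or> g1 = g2 \<and> (h1, h2) \<in> parcs H
      \<or> (g1, g2) \<in> parcs G \<and> (h1, h2) \<in> parcs H"
    using assms(3-6) by (auto simp: strong_product_def weak_product_def cartesian_product_def)
  moreover have "g1 \<noteq> g2" if "(g1, g2) \<in> parcs G"
    using that G.no_loops' by blast
  moreover have "h1 \<noteq> h2" if "(h1, h2) \<in> parcs H"
    using that H.no_loops' by blast
  ultimately show ?thesis
    by (cases "(g1, g2) \<in> parcs G"; cases "(h1, h2) \<in> parcs H") simp_all
qed

section \<open>The bound from the Chinese remainder labeling\<close>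

theorem proposition3p6:
  fixes G :: "'a pair_pre_digraph" and H :: "'b pair_pre_digraph"
    and N1 N2 s\<^sub>G s\<^sub>H :: nat
  assumes "pair_graph G" and "pair_graph H"
    and "graph_order G = N1" and "graph_order H = N2"
    and "coprime N1 N2"
    and "edge_count G = s\<^sub>G" and "edge_count H = s\<^sub>H"
    and "s\<^sub>G > 0" and "s\<^sub>H > 0"
  shows "edge_complexity (strong_product G H) \<le>
    (real N2 * sqrt (real s\<^sub>G) * edge_complexity G
      + real N1 * sqrt (real s\<^sub>H) * edge_complexity H
      + sqrt (2 * real s\<^sub>G * real s\<^sub>H) * edge_complexity G * edge_complexity H)
    / sqrt (real N2 * real s\<^sub>G + real N1 * real s\<^sub>H + 2 * real s\<^sub>G * real s\<^sub>H)"
proof -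
  interpret G: pair_graph G by fact
  interpret H: pair_graph H by fact
  let ?P = "strong_product G H" and ?N = "N1 * N2"
  let ?S = "real N2 * real s\<^sub>G + real N1 * real s\<^sub>H + 2 * real s\<^sub>G * real s\<^sub>H"
  have pos: "N1 > 0" "N2 > 0"
    using assms edge_count_pos_imp_order_pos by blast+
  obtain \<sigma> where \<sigma>: "vertex_labeling G \<sigma>"
      "edge_complexity G = fourier_ratio (adjacency_matrix G \<sigma>)"
    using edge_complexity_attained[OF G.pair_finite_verts] .
  obtain \<tau> where \<tau>: "vertex_labeling H \<tau>"
      "edge_complexity H = fourier_ratio (adjacency_matrix H \<tau>)"
    using edge_complexity_attained[OF H.pair_finite_verts] .
  define f where "f = inv_into (pverts G) \<sigma>"
  define g where "g = inv_into (pverts H) \<tau>"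
  define A where "A x y = (of_bool ((f x, f y) \<in> parcs G) :: complex)" for x y
  define B where "B x y = (of_bool ((g x, g y) \<in> parcs H) :: complex)" for x y
  define I where "I x y = (of_bool (x = y) :: complex)" for x y :: nat
  have f: "bij_betw f {..<N1} (pverts G)" and g: "bij_betw g {..<N2} (pverts H)"
    using assms \<sigma> \<tau> by (auto simp: f_def g_def vertex_labeling_def intro: bij_betw_inv_into)
  \<comment> \<open>The \<open>l1\<close> norm is recovered from the Fourier ratio of an optimal
    labeling by clearing the denominator \<open>sqrt (2 * real s\<^sub>G)\<close>, nonzero because
    there is an edge.\<close>
  have "dft2_l1 N1 A = sqrt (2 * real s\<^sub>G) * edge_complexity G"
    using assms pos \<sigma> by (simp add: fourier_ratio_adjacency_matrix A_def[abs_def] f_def)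
  moreover have "dft2_l1 N2 B = sqrt (2 * real s\<^sub>H) * edge_complexity H"
    using assms pos \<tau> by (simp add: fourier_ratio_adjacency_matrix B_def[abs_def] g_def)
  moreover have "dft2_l1 N I = real N" if "N > 0" for N
    using dft2_l1_identity[OF that] by (simp add: I_def[abs_def])
  ultimately have l1: "dft2_l1 N1 A = sqrt (2 * real s\<^sub>G) * edge_complexity G"
    "dft2_l1 N2 B = sqrt (2 * real s\<^sub>H) * edge_complexity H"
    "dft2_l1 N1 I = real N1" "dft2_l1 N2 I = real N2"
    using pos by auto

  \<comment> \<open>\<open>c\<close> goes from labels to vertices, the direction in which
    \<open>adjacency_matrix\<close> reads a labeling; the labeling itself is then obtained by
    inverting \<open>c\<close>.\<close>
  define c where "c x = (f (x mod N1), g (x mod N2))" for x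
  have "c = map_prod f g \<circ> (\<lambda>x. (1 * x mod N1, 1 * x mod N2))"
    by (auto simp: c_def)
  then have c: "bij_betw c {..<?N} (pverts ?P)"
    using bij_betw_trans[OF bij_betw_crt[of N1 N2 1 1] bij_betw_map_prod[OF f g]] assms pos
    by (simp add: strong_product_def)
  define \<rho> where "\<rho> = inv_into {..<?N} c"
  have \<rho>: "vertex_labeling ?P \<rho>"
    using bij_betw_inv_into[OF c] assms
    by (simp add: vertex_labeling_def \<rho>_def graph_order_strong_product)
  have inv_\<rho>: "inv_into (pverts ?P) \<rho> x = c x" if "x < ?N" for x
    using inv_into_inv_into_eq[OF c] that by (simp add: \<rho>_def)

  define T where "T U V x y = (U (x mod N1) (y mod N1) * V (x mod N2) (y mod N2) :: complex)"
    for U V :: "nat \<Rightarrow> nat \<Rightarrow> complex" and x y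
  have T: "dft2_l1 ?N (T U V) = dft2_l1 N1 U * dft2_l1 N2 V" for U V
    using dft2_l1_tensor[OF \<open>coprime N1 N2\<close> pos] by (simp add: T_def[abs_def])
  have decomp: "of_bool ((c x, c y) \<in> parcs ?P) = T A I x y + T I B x y + T A B x y" for x y
  proof -
    have "f (k mod N1) \<in> pverts G" "g (k mod N2) \<in> pverts H" for k
      using f g pos by (auto simp: bij_betw_def)
    \<comment> \<open>Injectivity of \<open>f\<close> and \<open>g\<close> turns equality of
      vertices into equality of residues, which is how the identity matrix \<open>I\<close> enters
      the tensor products.\<close>
    moreover have "f (x mod N1) = f (y mod N1) \<longleftrightarrow> x mod N1 = y mod N1"
      "g (x mod N2) = g (y mod N2) \<longleftrightarrow> x mod N2 = y mod N2"
      using f g pos by (auto simp: bij_betw_def inj_on_eq_iff)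
    ultimately show ?thesis
      unfolding c_def T_def A_def B_def I_def
      by (simp add: of_bool_strong_product_parcs[OF assms(1,2)])
  qed
  have "edge_complexity ?P \<le> fourier_ratio (adjacency_matrix ?P \<rho>)"
    by (rule edge_complexity_le[OF \<rho>])
  also have "\<dots> = dft2_l1 ?N (\<lambda>x y. T A I x y + T I B x y + T A B x y) / sqrt (2 * ?S)"
  proof -
    have "dft2_l1 ?N (\<lambda>x y. of_bool ((inv_into (pverts ?P) \<rho> x, inv_into (pverts ?P) \<rho> y) \<in> parcs ?P))
        = dft2_l1 ?N (\<lambda>x y. T A I x y + T I B x y + T A B x y)"
      by (rule dft2_l1_cong) (simp add: inv_\<rho> decomp)
    then show ?thesis
      using fourier_ratio_adjacency_matrix[OF pair_graph_strong_product[OF assms(1,2)] \<rho>] assms pos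
      by (simp add: graph_order_strong_product edge_count_strong_product)
  qed
  also have "\<dots> \<le> (dft2_l1 ?N (T A I) + dft2_l1 ?N (T I B) + dft2_l1 ?N (T A B)) / sqrt (2 * ?S)"
    using dft2_l1_add[of ?N "\<lambda>x y. T A I x y + T I B x y" "T A B"]
      dft2_l1_add[of ?N "T A I" "T I B"]
    by (intro divide_right_mono) auto
  \<comment> \<open>Every term releases one \<open>sqrt 2\<close>, the mixed one because
    \<open>sqrt (2 * s\<^sub>G) * sqrt (2 * s\<^sub>H)\<close> equals
    \<open>sqrt 2 * sqrt (2 * s\<^sub>G * s\<^sub>H)\<close>; it cancels against the
    \<open>sqrt 2\<close> from the doubled edge count in the denominator.\<close>
  also have "\<dots> = (sqrt 2 * (real N2 * sqrt (real s\<^sub>G) * edge_complexity G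
      + real N1 * sqrt (real s\<^sub>H) * edge_complexity H
      + sqrt (2 * real s\<^sub>G * real s\<^sub>H) * edge_complexity G * edge_complexity H))
    / (sqrt 2 * sqrt ?S)"
    unfolding T l1 real_sqrt_mult[of 2 ?S]
  proof (rule arg_cong[where f = "\<lambda>t. t / (sqrt 2 * sqrt ?S)"])
    show "sqrt (2 * real s\<^sub>G) * edge_complexity G * real N2
        + real N1 * (sqrt (2 * real s\<^sub>H) * edge_complexity H)
        + sqrt (2 * real s\<^sub>G) * edge_complexity G * (sqrt (2 * real s\<^sub>H) * edge_complexity H)
      = sqrt 2 * (real N2 * sqrt (real s\<^sub>G) * edge_complexity G
        + real N1 * sqrt (real s\<^sub>H) * edge_complexity H
        + sqrt (2 * real s\<^sub>G * real s\<^sub>H) * edge_complexity G * edge_complexity H)"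
      by (simp add: real_sqrt_mult algebra_simps)
  qed
  finally show ?thesis
    by simp
qed

end
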